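(* Let $\nu\in\mathbb{C}$ with $\operatorname{Re}\nu>-\tfrac12$ and let $x>0$. Put $c=e^{\mathrm{i}\pi/4}$ and $\overline{c}=e^{-\mathrm{i}\pi/4}$. Then the Kelvin functions of the first kind satisfy $$\mathrm{ber}_\nu(\sqrt2\,x)+\mathrm{i}\,\mathrm{bei}_\nu(\sqrt2\,x)=\frac{e^{\mathrm{i}5\pi\nu/4}}{\pi}\int_0^\pi e^{-cx\cos\theta}\,P\big(\{\nu\},-\mathrm{i}\sqrt2\,x(1+\cos\theta)\big)\,\cos\big[\nu\theta-\overline{c}\,x\sin\theta\big]\,\mathrm{d}\theta .$$
   Context: For $y>0$ the Kelvin functions are given by $\mathrm{ber}_\nu(y)+\mathrm{i}\,\mathrm{bei}_\nu(y)=e^{\mathrm{i}\pi\nu}J_\nu(y\,e^{-\mathrm{i}\pi/4})$ (for non-real $\nu$ the left-hand combination is understood as this expression). Equivalently, $\mathrm{ber}_\nu(y)+\mathrm{i}\,\mathrm{bei}_\nu(y)=e^{\mathrm{i}3\pi\nu/4}\sum_{k=0}^\infty\frac{y^k}{2^{k/2}k!}e^{\mathrm{i}k\pi/4}J_{\nu+k}(y)$. Here $J_\mu(z)=\left(\frac z2\right)^\mu\sum_{k=0}^\infty\frac{(-1)^k(z/2)^{2k}}{k!\,\Gamma(\mu+k+1)}$ is the Bessel function of the first kind with the principal branch of the power. The complex fractional part of $\nu$ is $\{\nu\}=\nu-[\operatorname{Re}\nu]$, where for real $t$, $[t]=\lfloor t\rfloor$ if $t\ge0$ and $[t]=\lceil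 t\rceil$ if $t<0$. $P(a,w)=\gamma(a,w)/\Gamma(a)$ is the regularized lower incomplete gamma function (principal branch in $w$), where $\gamma(a,w)=\int_0^w t^{a-1}e^{-t}\,\mathrm{d}t$ for $\operatorname{Re}a>0$. It is extended analytically to other $a$ by $P(a,w)=w^a\gamma^*(a,w)$, where $\gamma^*(a,w)=e^{-w}\sum_{n=0}^\infty\frac{w^n}{\Gamma(a+n+1)}$ is entire in both $a$ and $w$ (with $1/\Gamma=0$ at the poles of $\Gamma$). In particular $P(0,w)=1$. *)

theory Defs
  imports "HOL-Complex_Analysis.Complex_Analysis"
begin

section \<open>Powers\<close>

text \<open>
  The principal power of the library has \<open>0 powr 0 = 0\<close>; here \<open>z\<close> to the power \<open>0\<close> is
  \<open>1\<close> also for \<open>z = 0\<close>, so that \<open>J\<^sub>0(0) = 1\<close> and \<open>P(0, 0) = 1\<close>.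
\<close>

definition cpow :: "complex \<Rightarrow> complex \<Rightarrow> complex" where
  "cpow z a = (if a = 0 then 1 else z powr a)"


section \<open>Bessel and Kelvin functions of the first kind\<close>

text \<open>\<^const>\<open>rGamma\<close> is the entire function \<open>1/\<Gamma>\<close>.\<close>

definition Bessel_J :: "complex \<Rightarrow> complex \<Rightarrow> complex" where
  "Bessel_J \<mu> z =
     cpow (z / 2) \<mu> * (\<Sum>k. (-1) ^ k * (z / 2) ^ (2 * k) / fact k * rGamma (\<mu> + of_nat k + 1))"

text \<open>
  \<open>kelvin_ber_bei \<nu> y\<close> is the combination \<open>ber\<^sub>\<nu>(y) + \<i> bei\<^sub>\<nu>(y)\<close>. The separate functions
  are its real and imaginary part, and are defined for real order only.
\<close>

definition kelvin_ber_bei :: "complex \<Rightarrow> real \<Rightarrow> complex" where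
  "kelvin_ber_bei \<nu> y =
     exp (\<i> * of_real pi * \<nu>) * Bessel_J \<nu> (of_real y * exp (- (\<i> * of_real pi / 4)))"

definition ber :: "real \<Rightarrow> real \<Rightarrow> real" where
  "ber n y = Re (kelvin_ber_bei (of_real n) y)"

definition bei :: "real \<Rightarrow> real \<Rightarrow> real" where
  "bei n y = Im (kelvin_ber_bei (of_real n) y)"

lemma kelvin_ber_bei_of_real:
  "kelvin_ber_bei (of_real n) y = of_real (ber n y) + \<i> * of_real (bei n y)"
  by (simp add: ber_def bei_def complex_eq_iff)


section \<open>Complex fractional part\<close>

definition integer_part :: "real \<Rightarrow> int" where
  "integer_part t = (if t \<ge> 0 then \<lfloor>t\<rfloor> else \<lceil>t\<rceil>)"

definition complex_frac :: "complex \<Rightarrow> complex" where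
  "complex_frac \<nu> = \<nu> - of_int (integer_part (Re \<nu>))"


section \<open>Regularized lower incomplete gamma function\<close>

definition lower_gamma :: "complex \<Rightarrow> complex \<Rightarrow> complex" where
  "lower_gamma a w = contour_integral (linepath 0 w) (\<lambda>t. t powr (a - 1) * exp (- t))"

definition gamma_star :: "complex \<Rightarrow> complex \<Rightarrow> complex" where
  "gamma_star a w = exp (- w) * (\<Sum>n. w ^ n * rGamma (a + of_nat n + 1))"

text \<open>
  The defining formula is the one that is valid for all \<open>a\<close>; lemma \<open>gamma_P_eq_lower_gamma\<close>
  below shows that it is \<open>\<gamma>(a, w) / \<Gamma>(a)\<close> for \<open>Re a > 0\<close>.
\<close>

definition gamma_P :: "complex \<Rightarrow> complex \<Rightarrow> complex" where
  "gamma_P a w = cpow w a * gamma_star a w"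

lemma gamma_P_0: "gamma_P 0 w = 1"
proof -
  have "(\<lambda>n. w ^ n * rGamma (0 + of_nat n + 1)) = (\<lambda>n. w ^ n /\<^sub>R fact n)"
    by (simp add: fun_eq_iff rGamma_inverse_Gamma Gamma_fact scaleR_conv_of_real add.commute)
  then have "gamma_star 0 w = exp (- w) * exp w"
    by (simp add: gamma_star_def exp_def)
  then show ?thesis
    by (simp add: gamma_P_def cpow_def exp_minus)
qed

lemma summable_gamma_star:
  assumes "Re a > 0"
  shows "summable (\<lambda>n. rGamma (a + of_nat n + 1) * w ^ n)"
proof -
  obtain N :: nat where N: "real N > 2 * norm w"
    using reals_Archimedean2 by blast
  show ?thesis
  proof (rule summable_ratio_test[where c = "1/2" and N = N])
    fix n assume "n \<ge> N"
    define b where "b = a + of_nat n + 1"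
    have "norm b \<ge> real n"
      using complex_Re_le_cmod[of b] assms by (simp add: b_def)
    with \<open>n \<ge> N\<close> N have b: "norm b \<ge> 2 * norm w" by simp
    have "rGamma b = b * rGamma (b + 1)"
      by (rule rGamma_plus1[symmetric])
    then have "norm (rGamma b * w ^ n) = norm b * (norm (rGamma (b + 1)) * norm w ^ n)"
      by (simp add: norm_mult norm_power)
    also have "\<dots> \<ge> 2 * norm w * (norm (rGamma (b + 1)) * norm w ^ n)"
      by (intro mult_right_mono b) simp
    finally show "norm (rGamma (a + of_nat (Suc n) + 1) * w ^ Suc n)
        \<le> 1 / 2 * norm (rGamma (a + of_nat n + 1) * w ^ n)"
      by (simp add: b_def norm_mult norm_power algebra_simps)
  qed simp
qed

lemma gamma_P_has_contour_integral:
  assumes a: "Re a > 0"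
  shows "((\<lambda>t. t powr (a - 1) * exp (- t)) has_contour_integral (Gamma a * gamma_P a w))
           (linepath 0 w)"
proof (cases "w = 0")
  case True
  with a show ?thesis by (auto simp: gamma_P_def cpow_def)
next
  case False
  define c where "c = (\<lambda>n. rGamma (a + of_nat n + 1))"
  define F where "F = (\<lambda>z. \<Sum>n. c n * z ^ n)"
  define F' where "F' = (\<lambda>z. \<Sum>n. diffs c n * z ^ n)"
  have sm: "summable (\<lambda>n. c n * z ^ n)" for z
    using summable_gamma_star[OF a] by (simp add: c_def)
  have F_deriv: "(F has_field_derivative F' z) (at z)" for z
    unfolding F_def F'_def by (rule termdiffs_strong_converges_everywhere) (rule sm)
  have a_ne: "a \<noteq> 0" "Gamma a \<noteq> 0"
    using a by (auto simp: Gamma_eq_zero_iff elim!: nonpos_Ints_cases)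
  have ode: "z * F' z = rGamma a + z * F z - a * F z" for z
  proof -
    have smd: "summable (\<lambda>n. diffs c n * z ^ n)"
      by (rule termdiff_converges_all) (rule sm)
    have step: "of_nat (Suc n) * c (Suc n) = c n - a * c (Suc n)" for n
      using rGamma_plus1[of "a + of_nat n + 1"] by (simp add: c_def algebra_simps)
    have "z * F' z = (\<Sum>n. z * (diffs c n * z ^ n))"
      unfolding F'_def by (rule suminf_mult[OF smd, symmetric])
    also have "\<dots> = (\<Sum>n. z * (c n * z ^ n) - a * (c (Suc n) * z ^ Suc n))"
      unfolding diffs_def step by (simp add: algebra_simps)
    also have "\<dots> = (\<Sum>n. z * (c n * z ^ n)) - (\<Sum>n. a * (c (Suc n) * z ^ Suc n))"
      by (intro suminf_diff[symmetric] summable_mult sm)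
         (use sm summable_Suc_iff[of "\<lambda>n. c n * z ^ n"] in blast)
    also have "(\<Sum>n. z * (c n * z ^ n)) = z * F z"
      unfolding F_def by (rule suminf_mult[OF sm])
    also have "(\<Sum>n. a * (c (Suc n) * z ^ Suc n)) = a * (\<Sum>n. c (Suc n) * z ^ Suc n)"
      by (rule suminf_mult) (use sm summable_Suc_iff[of "\<lambda>n. c n * z ^ n"] in blast)
    also have "(\<Sum>n. c (Suc n) * z ^ Suc n) = F z - c 0"
      unfolding F_def using suminf_split_head[OF sm[of z]] by simp
    also have "a * (F z - c 0) = a * F z - rGamma a"
      using rGamma_plus1[of a] by (simp add: c_def algebra_simps)
    finally show ?thesis by simp
  qed
  define G where "G = (\<lambda>s. Gamma a * w powr a * (s powr a * (exp (- (s * w)) * F (s * w))))"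
  define g where "g = (\<lambda>s. (s * w) powr (a - 1) * exp (- (s * w)) * w)"
  have G_deriv: "(G has_field_derivative g (of_real s)) (at (of_real s))" if "s > 0" for s :: real
  proof -
    define z where "z = complex_of_real s"
    have z: "z \<notin> \<real>\<^sub>\<le>\<^sub>0" "z \<noteq> 0" using that by (auto simp: z_def)
    have pz: "z powr a = z * z powr (a - 1)" and pw: "w powr a = w * w powr (a - 1)"
      using z False by (simp_all add: powr_diff)
    have pzw: "(z * w) powr (a - 1) = z powr (a - 1) * w powr (a - 1)"
      using that by (intro powr_times_real_left) (auto simp: z_def)
    define E where "E = exp (- (z * w))"
    have d: "(G has_field_derivative
        Gamma a * w powr a * (z powr a * (E * (F' (z * w) * w) - w * E * F (z * w))
          + a * z powr (a - 1) * (E * F (z * w)))) (at z)"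
      unfolding G_def E_def
      by (rule derivative_eq_intros DERIV_chain2[OF F_deriv] refl z | simp add: algebra_simps)+
    have "z powr a * (E * (F' (z * w) * w) - w * E * F (z * w)) + a * z powr (a - 1) * (E * F (z * w))
        = z powr (a - 1) * E * ((z * w) * F' (z * w) - (z * w) * F (z * w) + a * F (z * w))"
      unfolding pz by (simp add: algebra_simps)
    also have "\<dots> = z powr (a - 1) * E * rGamma a"
      unfolding ode by simp
    finally have "Gamma a * w powr a * (z powr a * (E * (F' (z * w) * w) - w * E * F (z * w))
          + a * z powr (a - 1) * (E * F (z * w)))
        = Gamma a * rGamma a * (w powr a * z powr (a - 1) * E)"
      by simp
    also have "\<dots> = g z"
      using a_ne by (simp add: rGamma_inverse_Gamma g_def pzw pw E_def)
    finally show ?thesis using d by (simp add: z_def)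
  qed
  have cont_F: "continuous_on A F" for A
    by (meson F_deriv DERIV_isCont continuous_at_imp_continuous_on)
  have "continuous_on {0..1} (\<lambda>s. G (complex_of_real s))"
    unfolding G_def using a
    by (intro continuous_intros continuous_on_compose2[OF cont_F[of UNIV]]) auto
  then have "((\<lambda>s. g (complex_of_real s)) has_integral
      (G (complex_of_real 1) - G (complex_of_real 0))) {0..1}"
  proof (rule fundamental_theorem_of_calculus_interior[rotated])
    fix s :: real assume "s \<in> {0<..<1}"
    then show "((\<lambda>s. G (complex_of_real s)) has_vector_derivative g (complex_of_real s)) (at s)"
      using has_vector_derivative_real_field[OF G_deriv[of s]] by simp
  qed simp
  moreover have "G (complex_of_real 1) - G (complex_of_real 0) = Gamma a * gamma_P a w"
    using a_ne by (simp add: G_def gamma_P_def cpow_def gamma_star_def F_def c_def mult.commute)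
  ultimately show ?thesis
    unfolding has_contour_integral_linepath
    by (simp add: linepath_def g_def scaleR_conv_of_real)
qed

lemma gamma_P_eq_lower_gamma:
  assumes "Re a > 0"
  shows "gamma_P a w = lower_gamma a w / Gamma a"
proof -
  have "Gamma a \<noteq> 0"
    using assms by (auto simp: Gamma_eq_zero_iff elim!: nonpos_Ints_cases)
  then show ?thesis
    using contour_integral_unique[OF gamma_P_has_contour_integral[OF assms, of w]]
    by (simp add: lower_gamma_def)
qed

end

theory Submission
  imports Defs
begin

text \<open>
  On the unit circle \<open>z = e\<^sup>i\<^sup>\<theta>\<close> the argument of \<open>P\<close> is \<open>w = K (1 + z)\<^sup>2 / z\<close> with
  \<open>K = - i x / sqrt 2\<close>. Write \<open>\<nu> = \<mu> + n\<close> with \<open>\<mu> = {\<nu>}\<close>; since \<open>Re \<nu> > -1/2\<close>, \<open>n\<close> is a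
  natural number, and \<open>e\<^sup>i\<^sup>\<nu>\<^sup>\<theta> w\<^sup>\<mu> = K\<^sup>\<mu> z\<^sup>n (1 + z)\<^sup>2\<^sup>\<mu>\<close>. Splitting the cosine into exponentials turns
  the integral over \<open>[0, \<pi>]\<close> into the integral over the whole circle of
  \<open>z\<^sup>n (1 + z)\<^sup>2\<^sup>\<mu> e\<^sup>d\<^sup>z (\<Sum>\<^sub>m w\<^sup>m / \<Gamma>(\<mu> + m + 1))\<close> with \<open>d = - cnj c x\<close>, up to a constant factor.
  Expanding \<open>e\<^sup>d\<^sup>z\<close> and the sum leaves Fourier coefficients of \<open>(1 + z)\<^sup>b\<close>, which are binomial
  coefficients. The sum over \<open>m\<close> is then evaluated by Kummer's second transformation, and the
  remaining sum over the powers of \<open>d\<close> is a Taylor expansion in the argument of the Bessel function.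
\<close>

section \<open>The Bessel-Clifford function\<close>

text \<open>This is the regularized hypergeometric function \<open>0F1(; a + 1; t)\<close>, the
  branch-free factor of \<open>Bessel_J\<close>. Differentiation in \<open>t\<close> merely raises
  its order by one.\<close>

definition bessel_clifford :: "complex \<Rightarrow> complex \<Rightarrow> complex" where
  "bessel_clifford a t = (\<Sum>k. rGamma (a + of_nat k + 1) / fact k * t ^ k)"

lemma Bessel_J_conv_bessel_clifford:
  "Bessel_J \<nu> z = cpow (z / 2) \<nu> * bessel_clifford \<nu> (- ((z / 2)\<^sup>2))"
proof -
  have "(- ((z / 2)\<^sup>2)) ^ k = (- 1) ^ k * (z / 2) ^ (2 * k)" for k
    by (subst power_minus) (simp add: power_mult)
  then show ?thesis
    by (simp add: Bessel_J_def bessel_clifford_def algebra_simps)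
qed

text \<open>Dropping the first term replaces \<open>a\<close> by \<open>a + 1\<close>, which brings
  the range \<open>Re a > - 1\<close> back to \<open>summable_gamma_star\<close>. The norms serve as
  a majorant on the circle.\<close>

lemma summable_norm_gamma_star:
  assumes "Re a > - 1"
  shows "summable (\<lambda>n. norm (rGamma (a + of_nat n + 1)) * R ^ n)"
proof -
  have s: "summable (\<lambda>n. rGamma (a + of_nat n + 1) * w ^ n)" for w
  proof -
    have "summable (\<lambda>n. rGamma (a + 1 + of_nat n + 1) * w ^ n * w)"
      using assms by (intro summable_mult2 summable_gamma_star) simp
    then have "summable (\<lambda>n. rGamma (a + of_nat (Suc n) + 1) * w ^ Suc n)"
      by (simp add: algebra_simps)
    then show ?thesis
      by (subst (asm) summable_Suc_iff)
  qed
  have "summable (\<lambda>n. norm (rGamma (a + of_nat n + 1) * of_real \<bar>R\<bar> ^ n))"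
    \<comment> \<open>Convergence at the larger radius \<open>\<bar>R\<bar> + 1\<close> gives
      absolute convergence at \<open>\<bar>R\<bar>\<close>.\<close>
    by (rule powser_insidea[OF s[of "of_real (\<bar>R\<bar> + 1)"]]) simp
  then have "summable (\<lambda>n. norm (norm (rGamma (a + of_nat n + 1)) * R ^ n))"
    by (simp add: norm_mult norm_power power_abs abs_mult)
  then show ?thesis
    by (rule summable_norm_cancel)
qed

lemma summable_bessel_clifford:
  assumes "Re a > - 1"
  shows "summable (\<lambda>k. rGamma (a + of_nat k + 1) / fact k * t ^ k)"
proof (rule summable_comparison_test[OF _ summable_norm_gamma_star[OF assms, of "norm t"]],
       intro exI allI impI)
  fix k
  have "norm (rGamma (a + of_nat k + 1) / fact k * t ^ k)
      = norm (rGamma (a + of_nat k + 1)) * norm t ^ k / fact k"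
    by (simp add: norm_mult norm_divide norm_power)
  also have "\<dots> \<le> norm (rGamma (a + of_nat k + 1)) * norm t ^ k / 1"
    by (intro divide_left_mono) (auto intro: fact_ge_1)
  finally show "norm (rGamma (a + of_nat k + 1) / fact k * t ^ k)
      \<le> norm (rGamma (a + of_nat k + 1)) * norm t ^ k" by simp
qed

lemma has_field_derivative_bessel_clifford:
  assumes "Re a > - 1"
  shows "(bessel_clifford a has_field_derivative bessel_clifford (a + 1) t) (at t)"
proof -
  have diffs: "rGamma (a + 1 + of_nat k + 1) / fact k = diffs (\<lambda>k. rGamma (a + of_nat k + 1) / fact k) k" for k
    by (simp add: diffs_def del: of_nat_Suc) (simp add: add_ac)
  show ?thesis
    unfolding bessel_clifford_def diffs
    by (rule termdiffs_strong_converges_everywhere) (rule summable_bessel_clifford[OF assms])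
qed

text \<open>The \<open>j\<close>-th derivative is the function of order \<open>a + j\<close>, and
  the function is entire, so its Taylor series at \<open>t\<close> converges for every step
  \<open>h\<close>.\<close>

lemma bessel_clifford_taylor:
  assumes a: "Re a > - 1"
  shows "(\<lambda>j. h ^ j / fact j * bessel_clifford (a + of_nat j) t) sums bessel_clifford a (t + h)"
proof -
  have D: "(deriv ^^ j) (bessel_clifford a) = bessel_clifford (a + of_nat j)" for j
  proof (induction j)
    case (Suc j)
    have "Re (a + of_nat j) > - 1" using a by simp
    then have "deriv (bessel_clifford (a + of_nat j)) = bessel_clifford (a + of_nat j + 1)"
      by (intro ext DERIV_imp_deriv has_field_derivative_bessel_clifford)
    with Suc show ?case
      by (simp add: add_ac)
  qed simp
  have "bessel_clifford a holomorphic_on ball t (norm h + 1)"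
    using has_field_derivative_bessel_clifford[OF a]
    by (meson holomorphic_on_open open_ball)
  from holomorphic_power_series[OF this, of "t + h"] show ?thesis
    by (simp add: D dist_norm mult.commute)
qed

section \<open>Kummer's second transformation\<close>

text \<open>These are the coefficients that integration over the circle produces: a Fourier
  coefficient of a power of \<open>1 + z\<close> times a coefficient of \<open>gamma_star\<close>.
  For \<open>Re a > - 1 / 2\<close> their generating function is
  \<open>1F1(a + 1/2; 2a + 1; 4X)\<close> divided by \<open>Gamma (a + 1)\<close>.\<close>

definition kummer_coeff :: "complex \<Rightarrow> nat \<Rightarrow> complex" where
  "kummer_coeff a l = ((2 * a + 2 * of_nat l) gchoose l) * rGamma (a + of_nat l + 1)"

lemma kummer_coeff_Suc:
  assumes "Re a > - 1 / 2"
  shows "of_nat (Suc l) * (2 * a + of_nat l + 1) * kummer_coeff a (Suc l)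
       = 2 * (2 * a + 2 * of_nat l + 1) * kummer_coeff a l"
proof -
  define p where "p = 2 * a + of_nat l + 1"
  have G: "rGamma (a + of_nat l + 1) = (a + of_nat l + 1) * rGamma (a + of_nat l + 2)"
    using rGamma_plus1[of "a + of_nat l + 1"] by (simp add: add_ac)
  have c0: "kummer_coeff a l = pochhammer p l / fact l * rGamma (a + of_nat l + 1)"
    by (simp add: kummer_coeff_def gbinomial_pochhammer' p_def algebra_simps)
  have c1: "kummer_coeff a (Suc l) = pochhammer (p + 1) (Suc l) / fact (Suc l) * rGamma (a + of_nat l + 2)"
    by (simp add: kummer_coeff_def gbinomial_pochhammer' p_def algebra_simps)
  \<comment> \<open>Passing from \<open>l\<close> to \<open>Suc l\<close> moves both the start and
    the length of the Pochhammer product. The factor \<open>p\<close> restores the start and leaves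
    two new factors at the end.\<close>
  have P: "p * pochhammer (p + 1) (Suc l)
      = pochhammer p l * ((2 * a + 2 * of_nat l + 1) * (2 * (a + of_nat l + 1)))"
    unfolding pochhammer_rec[symmetric] by (simp add: pochhammer_Suc p_def algebra_simps)
  have "of_nat (Suc l) * p * kummer_coeff a (Suc l)
      = p * pochhammer (p + 1) (Suc l) / fact l * rGamma (a + of_nat l + 2)"
    unfolding c1 by (simp add: divide_simps del: of_nat_Suc)
  then show ?thesis
    unfolding P c0 G p_def[symmetric] by (simp del: of_nat_Suc) (simp add: algebra_simps)
qed


text \<open>
  Kummer's second transformation, read as \<open>e\<^sup>-\<^sup>2\<^sup>X H = U\<close> for formal power series: the recurrence of the
  coefficients of \<open>H\<close> is a second order differential equation, which becomes
  \<open>X U'' + (2a + 1) U' = 4 X U\<close> for \<open>U\<close>. This determines \<open>U\<close> from its constant term.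
\<close>
lemma kummer_coeff_fps:
  assumes a: "Re a > - 1 / 2"
  shows "Abs_fps (kummer_coeff a) = fps_exp 2 *
    Abs_fps (\<lambda>n. if even n then rGamma (a + of_nat (n div 2) + 1) / fact (n div 2) else 0)"
proof -
  define H E c where "H = Abs_fps (kummer_coeff a)" and "E = fps_exp (- 2 :: complex)"
    and "c = fps_const (2 * a + 1)"
  define U where "U = E * H"
  have "fps_X * fps_deriv (fps_deriv H) + fps_const (2 * a + 1) * fps_deriv H
      = 4 * fps_X * fps_deriv H + fps_const (2 * (2 * a + 1)) * H"
  proof (rule fps_ext)
    fix l
    show "(fps_X * fps_deriv (fps_deriv H) + fps_const (2 * a + 1) * fps_deriv H) $ l
      = (4 * fps_X * fps_deriv H + fps_const (2 * (2 * a + 1)) * H) $ l"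
      using kummer_coeff_Suc[OF a, of l]
      by (cases l) (simp_all add: H_def numeral_fps_const mult.assoc, simp_all add: algebra_simps)
  qed
  then have H: "fps_X * fps_deriv (fps_deriv H) + c * fps_deriv H
      = 4 * fps_X * fps_deriv H + 2 * c * H"
    by (simp add: c_def numeral_fps_const)
  have "fps_deriv E = - E - E"
    by (simp add: E_def fps_eq_iff)
  then have U: "fps_deriv U = E * (fps_deriv H - H - H)"
    and U': "fps_deriv (fps_deriv U) = E * (fps_deriv (fps_deriv H) - 4 * fps_deriv H + 4 * H)"
    by (simp_all add: U_def algebra_simps)
  have "fps_X * fps_deriv (fps_deriv U) + c * fps_deriv U
      = E * ((fps_X * fps_deriv (fps_deriv H) + c * fps_deriv H) - 4 * fps_X * fps_deriv H
             + 4 * fps_X * H - 2 * c * H)"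
    unfolding U' unfolding U by (simp add: algebra_simps)
  also have "\<dots> = 4 * fps_X * U"
    unfolding H by (simp add: U_def algebra_simps)
  finally have ode: "fps_X * fps_deriv (fps_deriv U) + c * fps_deriv U = 4 * fps_X * U" .
  \<comment> \<open>The recurrence skips one index. Its case \<open>n = 0\<close> forces
    \<open>U $ 1 = 0\<close>, so all odd coefficients vanish and the even ones follow from
    \<open>U $ 0\<close>.\<close>
  have rec: "of_nat (Suc n) * (of_nat n + 2 * a + 1) * U $ Suc n = (if n = 0 then 0 else 4 * U $ (n - 1))" for n
    using arg_cong[OF ode, of "\<lambda>F. F $ n"]
    by (cases n) (simp_all add: c_def numeral_fps_const mult.assoc, simp_all add: algebra_simps)
  have nz: "of_nat (Suc n) * (of_nat n + 2 * a + 1) \<noteq> 0" for n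
  proof -
    have "Re (of_nat n + 2 * a + 1) > 0" using a by simp
    then have "of_nat n + 2 * a + 1 \<noteq> 0" by (metis less_irrefl zero_complex.simps(1))
    then show ?thesis by (simp del: of_nat_Suc)
  qed
  have U: "U $ (2 * k) = rGamma (a + of_nat k + 1) / fact k \<and> U $ (2 * k + 1) = 0" for k
  proof (induction k)
    case 0
    then show ?case using rec[of 0] nz[of 0] by (simp add: U_def E_def H_def kummer_coeff_def)
  next
    case (Suc k)
    have "U $ (2 * k + 3) = 0"
      using rec[of "2 * k + 2"] nz[of "2 * k + 2"] Suc by (simp add: eval_nat_numeral)
    moreover have "of_nat (Suc (2 * k + 1)) * (of_nat (2 * k + 1) + 2 * a + 1)
        * (rGamma (a + of_nat (Suc k) + 1) / fact (Suc k)) = 4 * (rGamma (a + of_nat k + 1) / fact k)"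
    proof -
      have "rGamma (a + of_nat k + 1) = (a + of_nat k + 1) * rGamma (a + of_nat (Suc k) + 1)"
        using rGamma_plus1[of "a + of_nat k + 1"] by (simp add: add_ac)
      moreover have "of_nat (Suc (2 * k + 1)) * (of_nat (2 * k + 1) + 2 * a + 1)
          = 4 * (of_nat (Suc k) * (a + of_nat k + 1))"
        by (simp add: algebra_simps)
      ultimately show ?thesis
        by (simp del: of_nat_Suc)
    qed
    moreover have "of_nat (Suc (2 * k + 1)) * (of_nat (2 * k + 1) + 2 * a + 1) * U $ (2 * k + 2)
        = 4 * (rGamma (a + of_nat k + 1) / fact k)"
      using rec[of "2 * k + 1"] Suc by simp
    ultimately have "U $ (2 * k + 2) = rGamma (a + of_nat (Suc k) + 1) / fact (Suc k)"
      using nz[of "2 * k + 1"] by (metis mult_left_cancel)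
    with \<open>U $ (2 * k + 3) = 0\<close>
    show ?case by (simp add: eval_nat_numeral)
  qed
  have "U = Abs_fps (\<lambda>n. if even n then rGamma (a + of_nat (n div 2) + 1) / fact (n div 2) else 0)"
    using U by (auto simp: fps_eq_iff elim!: evenE oddE)
  moreover have "H = fps_exp 2 * U"
    by (simp add: U_def E_def mult.assoc[symmetric] fps_exp_add_mult[symmetric])
  ultimately show ?thesis
    by (simp add: H_def)
qed

text \<open>Both formal factors have infinite radius of convergence, so evaluation is multiplicative
  and the formal identity holds at every \<open>K\<close>.\<close>

lemma kummer_second_transformation:
  assumes a: "Re a > - 1 / 2"
  shows "(\<lambda>l. kummer_coeff a l * K ^ l) sums (exp (2 * K) * bessel_clifford a (K\<^sup>2))"
proof -
  define U where "U = Abs_fps (\<lambda>n. if even n then rGamma (a + of_nat (n div 2) + 1) / fact (n div 2) else 0)"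
  have U: "(\<lambda>n. U $ n * z ^ n) sums bessel_clifford a (z\<^sup>2)" for z
  proof -
    have "(\<lambda>k. rGamma (a + of_nat k + 1) / fact k * (z\<^sup>2) ^ k) sums bessel_clifford a (z\<^sup>2)"
      unfolding bessel_clifford_def using a by (intro summable_sums summable_bessel_clifford) simp
    also have "(\<lambda>k. rGamma (a + of_nat k + 1) / fact k * (z\<^sup>2) ^ k) = (\<lambda>k. U $ (2 * k) * z ^ (2 * k))"
      by (simp add: U_def power_mult)
    finally show ?thesis
      by (subst (asm) sums_mono_reindex) (auto simp: U_def strict_mono_def elim!: evenE)
  qed
  have "fps_conv_radius U = \<infinity>"
    unfolding fps_conv_radius_def by (rule conv_radius_inftyI'') (use U in \<open>auto simp: sums_iff\<close>)
  then have "eval_fps (fps_exp 2 * U) K = exp (2 * K) * eval_fps U K"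
    and "fps_conv_radius (fps_exp 2 * U) = \<infinity>"
    using fps_conv_radius_mult[of "fps_exp 2" U] by (simp_all add: eval_fps_mult)
  moreover have "eval_fps U K = bessel_clifford a (K\<^sup>2)"
    using U by (simp add: eval_fps_def sums_iff)
  ultimately have "(\<lambda>l. (fps_exp 2 * U) $ l * K ^ l) sums (exp (2 * K) * bessel_clifford a (K\<^sup>2))"
    using sums_eval_fps[of K "fps_exp 2 * U"] by simp
  then show ?thesis
    unfolding U_def kummer_coeff_fps[OF a, symmetric] by simp
qed

section \<open>Integrals over the unit circle\<close>

lemma absolutely_integrable_continuous_mult:
  fixes u G :: "real \<Rightarrow> complex"
  assumes G: "G absolutely_integrable_on {a..b}" and u: "continuous_on {a..b} u"
  shows "(\<lambda>t. u t * G t) absolutely_integrable_on {a..b}"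
proof (rule absolutely_integrable_bounded_measurable_product[OF bilinear_times _ _ _ G])
  show "u \<in> borel_measurable (lebesgue_on {a..b})"
    by (intro continuous_imp_measurable_on_sets_lebesgue u) simp
  show "bounded (u ` {a..b})"
    by (intro compact_imp_bounded compact_continuous_image u) simp
qed simp

text \<open>Dominated convergence for the partial sums, with majorant \<open>h\<close>. The factor
  \<open>G\<close> is kept apart from the bounded \<open>u\<close> because it may be unbounded:
  later it contains \<open>(1 + cis t) powr (2 * \<mu>)\<close>.\<close>

lemma power_series_integral:
  fixes u G :: "real \<Rightarrow> complex" and A :: "nat \<Rightarrow> complex"
  assumes G: "G absolutely_integrable_on {a..b}" and u: "continuous_on {a..b} u"
    and R: "\<And>t. t \<in> {a..b} \<Longrightarrow> norm (u t) \<le> R"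
    and sm: "summable (\<lambda>m. norm (A m) * R ^ m)"
  shows "(\<lambda>t. G t * (\<Sum>m. A m * u t ^ m)) absolutely_integrable_on {a..b}" (is ?abs)
    and "(\<lambda>m. A m * integral {a..b} (\<lambda>t. G t * u t ^ m)) sums
           integral {a..b} (\<lambda>t. G t * (\<Sum>m. A m * u t ^ m))" (is ?sums)
proof -
  have int: "(\<lambda>t. A m * (G t * u t ^ m)) absolutely_integrable_on {a..b}" for m
    using absolutely_integrable_continuous_mult[OF G, of "\<lambda>t. A m * u t ^ m"] u
    by (simp add: continuous_intros mult_ac)
  have term_le: "norm (A m * u t ^ m) \<le> norm (A m) * R ^ m" if "t \<in> {a..b}" for t m
    using R[OF that] by (simp add: norm_mult norm_power mult_left_mono power_mono)
  have smt: "summable (\<lambda>m. A m * u t ^ m)" if "t \<in> {a..b}" for t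
    by (rule summable_comparison_test'[OF sm]) (use term_le[OF that] in auto)
  define S where "S = (\<lambda>N t. \<Sum>m<N. A m * (G t * u t ^ m))"
  define h where "h = (\<lambda>t. norm (G t) * (\<Sum>m. norm (A m) * R ^ m))"
  have S: "S N absolutely_integrable_on {a..b}" for N
    unfolding S_def by (intro absolutely_integrable_sum int) auto
  have h: "h integrable_on {a..b}"
    using G unfolding h_def absolutely_integrable_on_def by (intro integrable_on_mult_left) simp
  have S_le: "norm (S N t) \<le> h t" if t: "t \<in> {a..b}" for N t
  proof -
    have R0: "0 \<le> R" using R[OF t] norm_ge_zero by (rule order_trans[rotated])
    have "norm (S N t) \<le> (\<Sum>m<N. norm (G t) * (norm (A m) * R ^ m))"
      unfolding S_def
    proof (rule sum_norm_le)
      fix m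
      show "norm (A m * (G t * u t ^ m)) \<le> norm (G t) * (norm (A m) * R ^ m)"
        using mult_left_mono[OF term_le[OF t, of m], of "norm (G t)"]
        by (simp add: norm_mult mult_ac)
    qed
    also have "\<dots> = norm (G t) * (\<Sum>m<N. norm (A m) * R ^ m)"
      by (simp add: sum_distrib_left)
    also have "\<dots> \<le> h t"
      unfolding h_def using R0 by (intro mult_left_mono sum_le_suminf sm) auto
    finally show ?thesis .
  qed
  have lim: "(\<lambda>N. S N t) \<longlonglongrightarrow> G t * (\<Sum>m. A m * u t ^ m)" if t: "t \<in> {a..b}" for t
    using tendsto_mult_left[OF summable_LIMSEQ[OF smt[OF t]], of "G t"]
    by (simp add: S_def sum_distrib_left mult_ac)
  show ?abs
    by (rule dominated_convergence_absolutely_integrable[OF S h _ lim])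
       (rule LIMSEQ_le_const2[OF tendsto_norm[OF lim]], use S_le in auto)
  have "(\<lambda>N. integral {a..b} (S N)) \<longlonglongrightarrow> integral {a..b} (\<lambda>t. G t * (\<Sum>m. A m * u t ^ m))"
    by (rule dominated_convergence(2)[OF set_lebesgue_integral_eq_integral(1)[OF S] h S_le lim])
  moreover have "integral {a..b} (S N) = (\<Sum>m<N. A m * integral {a..b} (\<lambda>t. G t * u t ^ m))" for N
    unfolding S_def
    by (subst integral_sum) (auto intro: set_lebesgue_integral_eq_integral(1)[OF int])
  ultimately show ?sums
    by (simp add: sums_def)
qed

section \<open>Size and integrability of powers of 1 + z on the circle\<close>

lemma one_plus_cis: "1 + cis t = of_real (2 * cos (t / 2)) * cis (t / 2)"
  using cos_double_cos[of "t / 2"] sin_double[of "t / 2"]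
  by (simp add: complex_eq_iff power2_eq_square mult_ac)

lemma norm_one_plus_cis: "t \<in> {-pi..pi} \<Longrightarrow> norm (1 + cis t) = 2 * cos (t / 2)"
  unfolding one_plus_cis by (simp add: norm_mult cos_ge_zero)

lemma one_plus_cis_nonzero:
  assumes "t \<in> {-pi<..<pi}"
  shows "1 + cis t \<notin> \<real>\<^sub>\<le>\<^sub>0" "Re (1 + cis t) > 0"
proof -
  have "cos (t / 2) > 0"
    using assms by (intro cos_gt_zero_pi) auto
  moreover have "Re (1 + cis t) = 2 * cos (t / 2) ^ 2"
    using cos_double_cos[of "t / 2"] by simp
  ultimately show *: "Re (1 + cis t) > 0"
    by simp
  then show "1 + cis t \<notin> \<real>\<^sub>\<le>\<^sub>0"
    using complex_nonpos_Reals_iff by force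
qed

text \<open>A concave function lies above its chord. This bounds \<open>norm (1 + cis t)\<close>
  below by a multiple of the distance to the endpoint, as needed for negative exponents.\<close>

lemma cos_half_ge:
  assumes "t \<in> {0..pi}"
  shows "cos (t / 2) \<ge> 1 - t / pi"
proof -
  have "convex_on {0..pi} (\<lambda>t. - cos (t / 2))"
  proof (rule f''_ge0_imp_convex)
    fix t assume t: "t \<in> {0..pi}"
    show "((\<lambda>t. - cos (t / 2)) has_real_derivative sin (t / 2) / 2) (at t)"
      by (auto intro!: derivative_eq_intros)
    show "((\<lambda>t. sin (t / 2) / 2) has_real_derivative cos (t / 2) / 4) (at t)"
      by (auto intro!: derivative_eq_intros)
    show "cos (t / 2) / 4 \<ge> 0"
      using t by (simp add: cos_ge_zero)
  qed simp
  from convex_onD[OF this, of "t / pi" 0 pi] show ?thesis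
    using assms by (auto simp: field_simps)
qed

text \<open>The argument contributes at most the factor \<open>C\<close>. For
  \<open>Re b < 0\<close> what remains is dominated by the distances to the two endpoints raised to
  the power \<open>Re b\<close>, which is integrable because \<open>Re b > - 1\<close>.\<close>

lemma absolutely_integrable_one_plus_cis_powr:
  assumes b: "Re b > - 1"
  shows "(\<lambda>t. (1 + cis t) powr b) absolutely_integrable_on {-pi..pi}"
proof -
  define C where "C = exp (pi * \<bar>Im b\<bar>)"
  define g where "g = (\<lambda>t. if Re b \<ge> 0 then C * 2 powr Re b
      else C * (((2 / pi) powr Re b) * ((pi - t) powr Re b + (pi + t) powr Re b)))"
  have meas: "(\<lambda>t. (1 + cis t) powr b) \<in> borel_measurable (lebesgue_on {-pi<..<pi})"
  proof (intro continuous_imp_measurable_on_sets_lebesgue continuous_intros)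
    show "0 < Re b" if "t \<in> {-pi<..<pi}" "1 + cis t = 0" for t
      using one_plus_cis_nonzero(2)[OF that(1)] that(2) by simp
    show "{-pi<..<pi} \<subseteq> {t. 0 \<le> Re (1 + cis t) \<or> Im (1 + cis t) \<noteq> 0}"
      using one_plus_cis_nonzero(2) less_imp_le by blast
  qed simp
  have "(\<lambda>t. (pi - t) powr Re b) integrable_on {-pi..pi}"
    using integrable_on_affinity[of "-1" "\<lambda>t. t powr Re b" 0 "2 * pi" pi]
      integrable_on_powr_from_0[OF b, of "2 * pi"] by simp
  moreover have "(\<lambda>t. (pi + t) powr Re b) integrable_on {-pi..pi}"
    using integrable_on_affinity[of 1 "\<lambda>t. t powr Re b" 0 "2 * pi" pi]
      integrable_on_powr_from_0[OF b, of "2 * pi"] by (simp add: add.commute)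
  ultimately have "g integrable_on {-pi..pi}"
    unfolding g_def by (cases "Re b \<ge> 0") (auto intro!: integrable_on_mult_right integrable_add)
  then have g: "g integrable_on {-pi<..<pi}"
    using integrable_on_Icc_iff_Ioo by blast
  have "norm ((1 + cis t) powr b) \<le> g t" if t: "t \<in> {-pi<..<pi}" for t
  proof -
    have "norm ((1 + cis t) powr b) = (2 * cos (t / 2)) powr Re b * exp (- Im b * Arg (1 + cis t))"
      using t by (subst norm_powr_complex) (simp add: norm_one_plus_cis)
    also have "\<dots> \<le> (2 * cos (t / 2)) powr Re b * C"
    proof -
      have "- Im b * Arg (1 + cis t) \<le> \<bar>Im b\<bar> * \<bar>Arg (1 + cis t)\<bar>"
        by (metis abs_ge_self abs_minus_cancel abs_mult)
      also have "\<dots> \<le> \<bar>Im b\<bar> * pi"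
        using Arg_bounded[of "1 + cis t"] by (intro mult_left_mono) auto
      finally show ?thesis
        unfolding C_def by (intro mult_left_mono) (simp_all add: mult.commute)
    qed
    also have "\<dots> \<le> g t"
    proof (cases "Re b \<ge> 0")
      case True
      then show ?thesis
        using t cos_ge_zero[of "t / 2"] by (simp add: g_def C_def powr_mono2)
    next
      case False
      \<comment> \<open>The distance from \<open>t\<close> to the nearer endpoint.\<close>
      define s where "s = (if t \<ge> 0 then pi - t else pi + t)"
      have s: "s > 0" using t by (auto simp: s_def)
      have "cos (t / 2) \<ge> s / pi"
        using cos_half_ge[of t] cos_half_ge[of "- t"] t by (auto simp: s_def diff_divide_distrib add_divide_distrib)
      then have "(2 * cos (t / 2)) powr Re b \<le> (2 / pi * s) powr Re b"
        using False s by (intro powr_mono2') auto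
      also have "\<dots> = (2 / pi) powr Re b * s powr Re b"
        by (rule powr_mult)
      also have "\<dots> \<le> (2 / pi) powr Re b * ((pi - t) powr Re b + (pi + t) powr Re b)"
        by (intro mult_left_mono) (auto simp: s_def)
      finally show ?thesis
        using False by (simp add: g_def C_def mult.commute)
    qed
    finally show ?thesis .
  qed
  then have "(\<lambda>t. (1 + cis t) powr b) absolutely_integrable_on {-pi<..<pi}"
    by (intro measurable_bounded_by_integrable_imp_absolutely_integrable[OF meas _ g]) auto
  then show ?thesis
    by (subst absolutely_integrable_on_Icc_iff_Ioo)
qed

lemma integral_circle_mean:
  assumes "continuous_on (cball 0 1) f" "f holomorphic_on ball 0 1"
  shows "integral {-pi..pi} (\<lambda>t. f (cis t)) = 2 * of_real pi * f 0"
proof -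
  \<comment> \<open>\<open>circlepath\<close> runs over \<open>[0, 2 \<pi>]\<close>; reflecting \<open>u\<close> shifts this to \<open>[-\<pi>, \<pi>]\<close>.\<close>
  have "((\<lambda>u. f (- u) / (u - 0)) has_contour_integral (2 * of_real pi * \<i> * f (- 0))) (circlepath 0 1)"
  proof (rule Cauchy_integral_circlepath[where f = "\<lambda>u. f (- u)"])
    show "continuous_on (cball 0 1) (\<lambda>u. f (- u))"
      by (rule continuous_on_compose2[OF assms(1)]) (auto intro!: continuous_intros)
    show "(\<lambda>u. f (- u)) holomorphic_on ball 0 1"
      by (rule holomorphic_on_compose_gen[OF _ assms(2), of uminus "ball 0 1", unfolded o_def])
         (auto intro!: holomorphic_intros)
  qed simp
  then have "((\<lambda>t. f (- cis t) / cis t * (\<i> * cis t)) has_integral (2 * of_real pi * \<i> * f 0)) {0..2 * pi}"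
    unfolding circlepath_def by (subst (asm) has_contour_integral_part_circlepath_iff) (auto simp: mult_ac)
  then have "((\<lambda>t. \<i> * f (cis (t - pi))) has_integral (\<i> * (2 * of_real pi * f 0))) {0..2 * pi}"
    by (simp add: cis_divide[symmetric] mult_ac)
  then have "((\<lambda>t. f (cis (t - pi))) has_integral (2 * of_real pi * f 0)) (cbox 0 (2 * pi))"
    by (subst (asm) has_integral_mult_right_iff) auto
  from has_integral_affinity'[OF this, of 1 pi]
  show ?thesis
    by (simp add: integral_unique)
qed

section \<open>Fourier coefficients of (1 + z)^b\<close>

text \<open>Up to the factor \<open>2 * pi\<close>, the Fourier coefficient of
  \<open>(1 + z) powr b\<close> at index \<open>- j\<close>. Recurrences determine it, since the
  binomial series does not converge absolutely on the circle when \<open>Re b < 0\<close>.\<close>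

definition circle_moment :: "complex \<Rightarrow> int \<Rightarrow> complex" where
  "circle_moment b j = integral {-pi..pi} (\<lambda>t. cis (of_int j * t) * (1 + cis t) powr b)"

lemma circle_moment_integrable:
  assumes "Re b > - 1"
  shows "(\<lambda>t. cis (of_int j * t) * (1 + cis t) powr b) absolutely_integrable_on {-pi..pi}"
  by (intro absolutely_integrable_continuous_mult absolutely_integrable_one_plus_cis_powr assms continuous_intros)

lemma circle_moment_add:
  assumes b: "Re b > - 1"
  shows "circle_moment (b + 1) j = circle_moment b j + circle_moment b (j + 1)"
proof -
  note int = set_lebesgue_integral_eq_integral(1)[OF circle_moment_integrable[OF b]]
  have "circle_moment b j + circle_moment b (j + 1)
      = integral {-pi..pi} (\<lambda>t. cis (of_int j * t) * (1 + cis t) powr b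
          + cis (of_int (j + 1) * t) * (1 + cis t) powr b)"
    unfolding circle_moment_def by (intro integral_add[symmetric] int)
  also have "\<dots> = circle_moment (b + 1) j"
    unfolding circle_moment_def
  proof (rule integral_spike)
    show "negligible {- pi, pi}" by simp
    fix t assume "t \<in> {-pi..pi} - {- pi, pi}"
    then have "1 + cis t \<noteq> 0"
      using one_plus_cis_nonzero(1)[of t] by force
    then have "(1 + cis t) powr (b + 1) = (1 + cis t) powr b * (1 + cis t)"
      by (simp add: powr_add)
    then show "cis (of_int j * t) * (1 + cis t) powr (b + 1)
        = cis (of_int j * t) * (1 + cis t) powr b + cis (of_int (j + 1) * t) * (1 + cis t) powr b"
      by (simp add: algebra_simps cis_mult)
  qed
  finally show ?thesis ..
qed

text \<open>Integrate the derivative of \<open>cis (j * t) * (1 + cis t) powr (b + 1)\<close>. As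
  \<open>Re (b + 1) > 0\<close>, this function is continuous up to the endpoints, where it
  vanishes.\<close>

lemma circle_moment_by_parts:
  assumes b: "Re b > - 1"
  shows "of_int j * circle_moment (b + 1) j + (b + 1) * circle_moment b (j + 1) = 0"
proof -
  define F where "F = (\<lambda>t. cis (of_int j * t) * (1 + cis t) powr (b + 1))"
  define F' where "F' = (\<lambda>t. \<i> * (of_int j * (cis (of_int j * t) * (1 + cis t) powr (b + 1))
      + (b + 1) * (cis (of_int (j + 1) * t) * (1 + cis t) powr b)))"
  have "(F' has_integral (F pi - F (- pi))) {-pi..pi}"
  proof (rule fundamental_theorem_of_calculus_interior)
    have "Re (1 + cis t) \<ge> 0" for t
      using cos_ge_minus_one[of t] by (simp del: cos_ge_minus_one)
    then show "continuous_on {-pi..pi} F"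
      unfolding F_def using b by (intro continuous_intros) auto
    fix t assume t: "t \<in> {-pi<..<pi}"
    \<comment> \<open>\<open>G\<close> extends \<open>F\<close> to a complex parameter, so that the
      complex differentiation rules apply away from the branch cut.\<close>
    define G where "G = (\<lambda>z. exp (\<i> * of_int j * z) * (1 + exp (\<i> * z)) powr (b + 1))"
    have F: "F = (\<lambda>t. G (of_real t))"
      by (simp add: F_def G_def cis_conv_exp mult_ac)
    have nz: "1 + exp (\<i> * of_real t) \<notin> \<real>\<^sub>\<le>\<^sub>0"
      using one_plus_cis_nonzero(1)[OF t] by (simp add: cis_conv_exp)
    have "(G has_field_derivative F' t) (at (of_real t))"
      unfolding G_def F'_def cis_conv_exp
      by (rule derivative_eq_intros refl nz | simp add: exp_add algebra_simps)+
    then show "(F has_vector_derivative F' t) (at t)"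
      unfolding F by (rule has_vector_derivative_real_field)
  qed simp
  moreover have minus_pi: "cis (- pi) = - 1"
    by (simp add: complex_eq_iff)
  moreover have "F pi = 0" "F (- pi) = 0"
    by (simp_all add: F_def minus_pi)
  moreover have "(F' has_integral 
      (\<i> * (of_int j * circle_moment (b + 1) j + (b + 1) * circle_moment b (j + 1)))) {-pi..pi}"
    unfolding F'_def circle_moment_def using b
    by (intro has_integral_mult_right has_integral_add integrable_integral
          set_lebesgue_integral_eq_integral(1)[OF circle_moment_integrable]) auto
  ultimately have "\<i> * (of_int j * circle_moment (b + 1) j + (b + 1) * circle_moment b (j + 1)) = 0"
    by (metis diff_self has_integral_unique)
  then show ?thesis by simp
qed

text \<open>Eliminating the exponent \<open>b + 1\<close> between the two preceding relations leaves
  a recurrence in \<open>j\<close> alone.\<close>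

lemma circle_moment_rec:
  assumes b: "Re b > - 1"
  shows "of_int j * circle_moment b j = - (b + 1 + of_int j) * circle_moment b (j + 1)"
  using circle_moment_by_parts[OF b, of j] unfolding circle_moment_add[OF b]
  by (simp add: algebra_simps eq_neg_iff_add_eq_0)

text \<open>Integration by parts with \<open>j = 0\<close> kills the moment at \<open>1\<close>,
  because \<open>b + 1\<close> is nonzero. The recurrence carries this upwards, its factor
  \<open>b + 1 + j\<close> never vanishing.\<close>

lemma circle_moment_pos:
  assumes b: "Re b > - 1"
  shows "circle_moment b (int (Suc j)) = 0"
proof (induction j)
  case 0
  have "b + 1 \<noteq> 0" using b by (auto simp: complex_eq_iff)
  moreover have "(b + 1) * circle_moment b 1 = 0"
    using circle_moment_by_parts[OF b, of 0] by simp
  ultimately have "circle_moment b 1 = 0"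
    using mult_eq_0_iff by blast
  then show ?case by simp
next
  case (Suc j)
  have "Re (b + 1 + of_int (int (Suc j))) > 0" using b by simp
  then have "b + 1 + of_int (int (Suc j)) \<noteq> 0" by (metis less_irrefl zero_complex.simps(1))
  moreover have "(b + 1 + of_int (int (Suc j))) * circle_moment b (int (Suc j) + 1) = 0"
    using circle_moment_rec[OF b, of "int (Suc j)"] Suc
    by (metis add.inverse_inverse minus_mult_left mult_zero_right neg_equal_0_iff_equal)
  ultimately have "circle_moment b (int (Suc j) + 1) = 0"
    using mult_eq_0_iff by blast
  moreover have "int (Suc j) + 1 = int (Suc (Suc j))" by simp
  ultimately show ?case by metis
qed

text \<open>The recurrence says nothing about the moment at \<open>0\<close>. It comes from the mean
  value property for the exponent \<open>b + 1\<close>, where the function is continuous on the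
  closed disc; the vanishing moment at \<open>1\<close> then allows the descent to
  \<open>b\<close>.\<close>

lemma circle_moment_zero:
  assumes b: "Re b > - 1"
  shows "circle_moment b 0 = 2 * of_real pi"
proof -
  have Re: "Re (1 + z) > 0" if "norm z < 1" for z :: complex
    using abs_Re_le_cmod[of z] that by simp
  have Re': "Re (1 + z) \<ge> 0" if "norm z \<le> 1" for z :: complex
    using abs_Re_le_cmod[of z] that by simp
  have "integral {-pi..pi} (\<lambda>t. (1 + cis t) powr (b + 1)) = 2 * of_real pi * (1 + 0) powr (b + 1)"
  proof (rule integral_circle_mean)
    show "continuous_on (cball 0 1) (\<lambda>z. (1 + z) powr (b + 1))"
      using b Re' by (intro continuous_intros) auto
    have "1 + z \<notin> \<real>\<^sub>\<le>\<^sub>0" if "z \<in> ball 0 1" for z :: complex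
      using Re[of z] that by (simp add: complex_nonpos_Reals_iff)
    then show "(\<lambda>z. (1 + z) powr (b + 1)) holomorphic_on ball 0 1"
      by (intro holomorphic_intros) auto
  qed
  then have "circle_moment (b + 1) 0 = 2 * of_real pi"
    by (simp add: circle_moment_def)
  with circle_moment_add[OF b, of 0] circle_moment_pos[OF b, of 0] show ?thesis
    by simp
qed

text \<open>Read downwards from \<open>0\<close>, the recurrence is that of the binomial
  coefficients.\<close>

lemma circle_moment_neg:
  assumes b: "Re b > - 1"
  shows "circle_moment b (- int k) = 2 * of_real pi * (b gchoose k)"
proof (induction k)
  case 0
  then show ?case using circle_moment_zero[OF b] by simp
next
  case (Suc k)
  have e: "- int (Suc k) + 1 = - int k" by simp
  have "of_nat (Suc k) * circle_moment b (- int (Suc k)) = (b - of_nat k) * circle_moment b (- int k)"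
    using circle_moment_rec[OF b, of "- int (Suc k)"] unfolding e by (simp add: algebra_simps minus_equation_iff)
  also have "\<dots> = 2 * of_real pi * ((b - of_nat k) * (b gchoose k))"
    by (simp add: Suc)
  also have "(b - of_nat k) * (b gchoose k) = of_nat (Suc k) * (b gchoose Suc k)"
    using gbinomial_absorb_comp[of b k] gbinomial_absorption[of k b] by simp
  finally have "of_nat (Suc k) * circle_moment b (- int (Suc k))
      = of_nat (Suc k) * (2 * of_real pi * (b gchoose Suc k))"
    by (simp only: mult_ac)
  then show ?case
    by (simp del: of_nat_Suc)
qed

section \<open>The kernel on the circle and its integrals\<close>

lemma of_real_cis_powr:
  assumes "r > 0" "- pi < \<phi>" "\<phi> \<le> pi"
  shows "(of_real r * cis \<phi>) powr a = of_real r powr a * exp (\<i> * of_real \<phi> * a)"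
proof -
  have "of_real r * cis \<phi> = exp (of_real (ln r) + \<i> * of_real \<phi>)"
    using assms(1) by (simp add: exp_add cis_conv_exp exp_of_real)
  then have "Ln (of_real r * cis \<phi>) = of_real (ln r) + \<i> * of_real \<phi>"
    using assms by (simp add: Ln_exp)
  then show ?thesis
    using assms(1) by (simp add: powr_def Ln_of_real exp_add[symmetric] algebra_simps)
qed

text \<open>With \<open>w\<close> the argument of the series, this is
  \<open>exp (\<i> * t * \<mu>) * gamma_P \<mu> w\<close> inside the interval, freed of the factors
  \<open>K powr \<mu>\<close> and \<open>exp (- w)\<close>. Only a power of \<open>1 + z\<close> is
  left to carry a branch.\<close>

definition circle_kernel :: "complex \<Rightarrow> complex \<Rightarrow> real \<Rightarrow> complex" where
  "circle_kernel \<mu> K t = (1 + cis t) powr (2 * \<mu>) *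
     (\<Sum>m. rGamma (\<mu> + of_nat m + 1) * (K * (1 + cis t)\<^sup>2 * cis (- t)) ^ m)"

text \<open>The \<open>m\<close>-th term of the series contributes a moment with index
  \<open>N - m\<close>, which vanishes for \<open>m < N\<close>. Substituting
  \<open>m = l + N\<close> turns the rest into the Kummer series of order
  \<open>\<mu> + N\<close>.\<close>

lemma
  assumes \<mu>: "Re \<mu> > - 1 / 2"
  shows circle_kernel_integrable:
      "(\<lambda>t. cis t ^ N * circle_kernel \<mu> K t) absolutely_integrable_on {-pi..pi}" (is ?abs)
    and circle_kernel_moment:
      "integral {-pi..pi} (\<lambda>t. cis t ^ N * circle_kernel \<mu> K t)
         = 2 * of_real pi * K ^ N * (exp (2 * K) * bessel_clifford (\<mu> + of_nat N) (K\<^sup>2))" (is ?int)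
proof -
  define G where "G = (\<lambda>t. cis t ^ N * (1 + cis t) powr (2 * \<mu>))"
  define u where "u = (\<lambda>t. K * (1 + cis t)\<^sup>2 * cis (- t))"
  define I where "I = integral {-pi..pi} (\<lambda>t. G t * (\<Sum>m. rGamma (\<mu> + of_nat m + 1) * u t ^ m))"
  have Gu: "(\<lambda>t. cis t ^ N * circle_kernel \<mu> K t) = (\<lambda>t. G t * (\<Sum>m. rGamma (\<mu> + of_nat m + 1) * u t ^ m))"
    by (simp add: G_def u_def circle_kernel_def mult_ac)
  have G: "G absolutely_integrable_on {-pi..pi}"
    using circle_moment_integrable[of "2 * \<mu>" "int N"] \<mu> by (simp add: G_def Complex.DeMoivre)
  have u: "continuous_on {-pi..pi} u"
    unfolding u_def by (intro continuous_intros)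
  have R: "norm (u t) \<le> 4 * norm K" for t
  proof -
    have "norm (1 + cis t) ^ 2 \<le> 2 ^ 2"
      using norm_triangle_ineq[of 1 "cis t"] by (intro power_mono) auto
    then show ?thesis
      using mult_left_mono[of "norm (1 + cis t) ^ 2" 4 "norm K"]
      by (simp add: u_def norm_mult norm_power mult_ac)
  qed
  have sm: "summable (\<lambda>m. norm (rGamma (\<mu> + of_nat m + 1)) * (4 * norm K) ^ m)"
    using \<mu> by (intro summable_norm_gamma_star) simp
  note series = power_series_integral[OF G u R sm]
  show ?abs
    unfolding Gu by (rule series(1))
  have mom: "integral {-pi..pi} (\<lambda>t. G t * u t ^ m)
      = K ^ m * circle_moment (2 * \<mu> + 2 * of_nat m) (int N - int m)" for m
  proof -
    have "integral {-pi..pi} (\<lambda>t. G t * u t ^ m) = integral {-pi..pi} (\<lambda>t. K ^ m *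
        (cis (of_int (int N - int m) * t) * (1 + cis t) powr (2 * \<mu> + 2 * of_nat m)))"
    proof (rule integral_spike)
      show "negligible {- pi, pi}" by simp
      fix t assume "t \<in> {-pi..pi} - {- pi, pi}"
      then have nz: "1 + cis t \<noteq> 0"
        using one_plus_cis_nonzero(1)[of t] by force
      have "(1 + cis t) powr (2 * \<mu> + 2 * of_nat m) = (1 + cis t) powr (2 * \<mu>) * ((1 + cis t)\<^sup>2) ^ m"
        using nz powr_nat'[of "1 + cis t" "2 * m"] by (simp add: powr_add power_mult)
      moreover have "cis (of_int (int N - int m) * t) = cis t ^ N * cis (- t) ^ m"
        by (simp add: Complex.DeMoivre cis_mult algebra_simps)
      ultimately show "K ^ m * (cis (of_int (int N - int m) * t) * (1 + cis t) powr (2 * \<mu> + 2 * of_nat m))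
          = G t * u t ^ m"
        by (simp add: G_def u_def power_mult_distrib mult_ac)
    qed
    then show ?thesis by (simp add: circle_moment_def)
  qed
  have b: "Re (2 * \<mu> + 2 * of_nat m) > - 1" for m
    using \<mu> by simp
  have "(\<lambda>m. rGamma (\<mu> + of_nat m + 1) * (K ^ m * circle_moment (2 * \<mu> + 2 * of_nat m) (int N - int m))) sums I"
    using series(2) unfolding mom I_def by simp
  moreover have "circle_moment (2 * \<mu> + 2 * of_nat m) (int N - int m) = 0" if "m < N" for m
    using circle_moment_pos[OF b, of m "N - m - 1"] that by (simp add: of_nat_diff)
  ultimately have "(\<lambda>l. rGamma (\<mu> + of_nat (l + N) + 1) * (K ^ (l + N) *
      circle_moment (2 * \<mu> + 2 * of_nat (l + N)) (int N - int (l + N)))) sums I"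
    by (subst sums_zero_iff_shift) auto
  moreover have "circle_moment (2 * \<mu> + 2 * of_nat (l + N)) (int N - int (l + N))
      = 2 * of_real pi * ((2 * (\<mu> + of_nat N) + 2 * of_nat l) gchoose l)" for l
    using circle_moment_neg[OF b, of "l + N" l] by (simp add: algebra_simps)
  then have "(\<lambda>l. rGamma (\<mu> + of_nat (l + N) + 1) * (K ^ (l + N) *
        circle_moment (2 * \<mu> + 2 * of_nat (l + N)) (int N - int (l + N))))
      = (\<lambda>l. 2 * of_real pi * K ^ N * (kummer_coeff (\<mu> + of_nat N) l * K ^ l))"
    by (simp add: kummer_coeff_def fun_eq_iff power_add mult_ac add_ac)
  ultimately have "(\<lambda>l. 2 * of_real pi * K ^ N * (kummer_coeff (\<mu> + of_nat N) l * K ^ l)) sums I"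
    by (simp only:)
  moreover have "(\<lambda>l. 2 * of_real pi * K ^ N * (kummer_coeff (\<mu> + of_nat N) l * K ^ l)) sums
      (2 * of_real pi * K ^ N * (exp (2 * K) * bessel_clifford (\<mu> + of_nat N) (K\<^sup>2)))"
    using \<mu> by (intro sums_mult kummer_second_transformation) simp
  ultimately show ?int
    unfolding Gu I_def[symmetric] by (rule sums_unique2)
qed

text \<open>Expanding \<open>exp (d * cis t)\<close> raises the power of \<open>cis t\<close> to
  \<open>n + j\<close>, hence the order to \<open>\<mu> + n + j\<close>, and supplies another
  \<open>K ^ j\<close>. The result is the Taylor series at \<open>K\<^sup>2\<close> with step
  \<open>d * K\<close>.\<close>

lemma
  assumes \<mu>: "Re \<mu> > - 1 / 2"
  shows circle_kernel_exp_integrable: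
      "(\<lambda>t. cis t ^ n * circle_kernel \<mu> K t * exp (d * cis t)) absolutely_integrable_on {-pi..pi}" (is ?abs)
    and circle_kernel_exp_integral:
      "integral {-pi..pi} (\<lambda>t. cis t ^ n * circle_kernel \<mu> K t * exp (d * cis t))
         = 2 * of_real pi * K ^ n * exp (2 * K) * bessel_clifford (\<mu> + of_nat n) (K\<^sup>2 + d * K)" (is ?int)
proof -
  have e: "exp (d * z) = (\<Sum>j. d ^ j / fact j * z ^ j)" for z
    by (simp add: exp_def scaleR_conv_of_real power_mult_distrib field_simps)
  have sm: "summable (\<lambda>j. norm (d ^ j / fact j) * 1 ^ j)"
    using summable_norm_exp[of d] by (simp add: norm_mult norm_power norm_inverse divide_inverse mult.commute)
  have u: "continuous_on {-pi..pi} cis"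
    by (intro continuous_intros)
  note series = power_series_integral[OF circle_kernel_integrable[OF \<mu>, of n] u _ sm, folded e]
  show ?abs by (rule series(1)) simp
  have "(\<lambda>j. d ^ j / fact j * integral {-pi..pi} (\<lambda>t. cis t ^ n * circle_kernel \<mu> K t * cis t ^ j)) sums
      integral {-pi..pi} (\<lambda>t. cis t ^ n * circle_kernel \<mu> K t * exp (d * cis t))"
    by (rule series(2)) simp
  also have "(\<lambda>j. d ^ j / fact j * integral {-pi..pi} (\<lambda>t. cis t ^ n * circle_kernel \<mu> K t * cis t ^ j))
      = (\<lambda>j. 2 * of_real pi * K ^ n * exp (2 * K) *
            ((d * K) ^ j / fact j * bessel_clifford (\<mu> + of_nat n + of_nat j) (K\<^sup>2)))"
    using circle_kernel_moment[OF \<mu>, of "n + _"]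
    by (simp add: fun_eq_iff power_add power_mult_distrib mult_ac add_ac)
  finally have "(\<lambda>j. 2 * of_real pi * K ^ n * exp (2 * K) *
            ((d * K) ^ j / fact j * bessel_clifford (\<mu> + of_nat n + of_nat j) (K\<^sup>2))) sums
      integral {-pi..pi} (\<lambda>t. cis t ^ n * circle_kernel \<mu> K t * exp (d * cis t))" .
  moreover have "(\<lambda>j. 2 * of_real pi * K ^ n * exp (2 * K) *
            ((d * K) ^ j / fact j * bessel_clifford (\<mu> + of_nat n + of_nat j) (K\<^sup>2))) sums
      (2 * of_real pi * K ^ n * exp (2 * K) * bessel_clifford (\<mu> + of_nat n) (K\<^sup>2 + d * K))"
    using \<mu> by (intro sums_mult bessel_clifford_taylor) simp
  ultimately show ?int
    by (rule sums_unique2)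
qed

section \<open>The integral representation\<close>

lemma integral_fold_symmetric:
  fixes F :: "real \<Rightarrow> complex"
  assumes F: "F absolutely_integrable_on {- a..a}" and a: "0 \<le> a"
  shows "(\<lambda>t. F t + F (- t)) absolutely_integrable_on {0..a}"
    and "integral {0..a} (\<lambda>t. F t + F (- t)) = integral {- a..a} F"
proof -
  have pos: "F absolutely_integrable_on {0..a}" and neg: "F absolutely_integrable_on {- a..0}"
    using a by (auto intro: absolutely_integrable_on_subinterval[OF F])
  have neg': "(\<lambda>t. F (- t)) absolutely_integrable_on {0..a}"
    using neg by (subst (asm) absolutely_integrable_reflect_real[symmetric]) simp
  show "(\<lambda>t. F t + F (- t)) absolutely_integrable_on {0..a}"
    using set_integral_add(1)[OF pos neg'] .
  have "integral {0..a} (\<lambda>t. F t + F (- t)) = integral {0..a} F + integral {- 0..- (- a)} (\<lambda>t. F (- t))"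
    using set_lebesgue_integral_eq_integral(1)[OF pos] set_lebesgue_integral_eq_integral(1)[OF neg']
    by (simp add: integral_add)
  also have "integral {- 0..- (- a)} (\<lambda>t. F (- t)) = integral {- a..0} F"
    by (rule Henstock_Kurzweil_Integration.integral_reflect_real)
  also have "integral {0..a} F + integral {- a..0} F = integral {- a..a} F"
    using Henstock_Kurzweil_Integration.integral_combine[OF _ a set_lebesgue_integral_eq_integral(1)[OF F]] a
    by (simp add: add.commute)
  finally show "integral {0..a} (\<lambda>t. F t + F (- t)) = integral {- a..a} F" .
qed

lemma of_real_square_powr:
  assumes "r > 0"
  shows "(of_real (r\<^sup>2) :: complex) powr a = of_real r powr (2 * a)"
  using assms by (simp add: powr_def Ln_of_real ln_realpow mult_ac flip: of_real_power)

section \<open>From the incomplete gamma function to the kernel\<close>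

text \<open>Apart from \<open>exp (\<i> * of_real t * \<mu>)\<close> every factor is even in
  \<open>t\<close>, which is what later pairs \<open>t\<close> with \<open>- t\<close>.\<close>

lemma circle_kernel_eq:
  assumes t: "t \<in> {-pi<..<pi}"
  shows "circle_kernel \<mu> K t = of_real (2 * cos (t / 2)) powr (2 * \<mu>) * exp (\<i> * of_real t * \<mu>)
    * (\<Sum>m. rGamma (\<mu> + of_nat m + 1) * (2 * K * of_real (1 + cos t)) ^ m)"
proof -
  have "cos (t / 2) > 0"
    using t by (intro cos_gt_zero_pi) auto
  then have powr: "(1 + cis t) powr (2 * \<mu>)
      = of_real (2 * cos (t / 2)) powr (2 * \<mu>) * exp (\<i> * of_real (t / 2) * (2 * \<mu>))"
    unfolding one_plus_cis using t by (intro of_real_cis_powr) auto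
  have arg: "K * (1 + cis t)\<^sup>2 * cis (- t) = 2 * K * of_real (1 + cos t)"
  proof -
    have "(1 + cis t)\<^sup>2 * cis (- t) = of_real (2 * (2 * (cos (t / 2))\<^sup>2)) * (cis t * cis (- t))"
      unfolding one_plus_cis by (simp add: power_mult_distrib Complex.DeMoivre)
    also have "2 * (cos (t / 2))\<^sup>2 = 1 + cos t"
      using cos_double_cos[of "t / 2"] by simp
    finally show ?thesis by (simp add: cis_mult mult_ac)
  qed
  show ?thesis
    unfolding circle_kernel_def powr arg by (simp add: mult_ac)
qed

text \<open>The argument of \<open>gamma_P\<close> is a positive multiple \<open>r\<^sup>2\<close>
  of \<open>K\<close>, so the principal power splits without a branch correction.\<close>

lemma gamma_P_conv_circle_kernel:
  assumes t: "t \<in> {-pi<..<pi}" and K: "K \<noteq> 0"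
  shows "exp (\<i> * of_real t * \<mu>) * gamma_P \<mu> (2 * K * of_real (1 + cos t))
    = K powr \<mu> * exp (- (2 * K * of_real (1 + cos t))) * circle_kernel \<mu> K t"
proof -
  define r where "r = 2 * cos (t / 2)"
  have r: "r > 0"
    unfolding r_def using t by (simp add: cos_gt_zero_pi)
  have w: "2 * K * of_real (1 + cos t) = of_real (r\<^sup>2) * K"
    using cos_double_cos[of "t / 2"] by (simp add: r_def power_mult_distrib)
  have "cpow (2 * K * of_real (1 + cos t)) \<mu> = (of_real (r\<^sup>2) * K) powr \<mu>"
    unfolding w using r K by (simp add: cpow_def)
  also have "\<dots> = of_real r powr (2 * \<mu>) * K powr \<mu>"
    using r by (subst powr_times_real_left) (simp_all only: of_real_square_powr, simp_all)
  finally show ?thesis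
    by (simp add: gamma_P_def gamma_star_def circle_kernel_eq[OF t] r_def mult_ac)
qed

lemma integer_part_nonneg:
  assumes "t > - 1"
  shows "integer_part t \<ge> 0"
  using assms by (auto simp: integer_part_def)

text \<open>Rounding is towards zero: if \<open>Re \<nu>\<close> is negative here,
  \<open>\<nu>\<close> is its own fractional part, and otherwise the fractional part has nonnegative
  real part.\<close>

lemma Re_complex_frac:
  assumes "Re \<nu> > - 1 / 2"
  shows "Re (complex_frac \<nu>) > - 1 / 2"
proof (cases "Re \<nu> \<ge> 0")
  case False
  then have "\<lceil>Re \<nu>\<rceil> = 0" using assms by (simp add: ceiling_eq_iff)
  with False show ?thesis using assms by (simp add: complex_frac_def integer_part_def)
next
  case True
  then have "Re (complex_frac \<nu>) \<ge> 0" by (simp add: complex_frac_def integer_part_def)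
  then show ?thesis by simp
qed

theorem mainTheorem6:
  fixes \<nu> :: complex and x :: real
  defines "c \<equiv> exp (\<i> * of_real pi / 4)"
  defines "f \<equiv> (\<lambda>\<theta>::real.
      exp (- (c * of_real x * of_real (cos \<theta>)))
      * gamma_P (complex_frac \<nu>) (- \<i> * of_real (sqrt 2 * x * (1 + cos \<theta>)))
      * cos (\<nu> * of_real \<theta> - cnj c * of_real x * of_real (sin \<theta>)))"
  assumes "Re \<nu> > - 1 / 2" and "x > 0"
  shows "f absolutely_integrable_on {0..pi}
    \<and> kelvin_ber_bei \<nu> (sqrt 2 * x)
        = exp (\<i> * 5 * of_real pi * \<nu> / 4) / of_real pi * integral {0..pi} f"
proof -
  define \<mu> n where "\<mu> = complex_frac \<nu>" and "n = nat (integer_part (Re \<nu>))"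
  define s where "s = x / sqrt 2"
  \<comment> \<open>\<open>K\<close> makes the argument of \<open>gamma_P\<close> equal to
    \<open>2 * K * (1 + cos t)\<close>, and \<open>d\<close> is the coefficient of
    \<open>sin t\<close> inside the cosine.\<close>
  define K d where "K = - \<i> * of_real s" and "d = - cnj c * of_real x"
  define F where "F = (\<lambda>t. cis t ^ n * circle_kernel \<mu> K t * exp (d * cis t))"
  have n: "\<nu> = \<mu> + of_nat n"
    using integer_part_nonneg[of "Re \<nu>"] assms(3) by (simp add: \<mu>_def n_def complex_frac_def)
  have \<mu>: "Re \<mu> > - 1 / 2"
    unfolding \<mu>_def by (rule Re_complex_frac) (rule assms(3))
  have s: "s > 0" "sqrt 2 * x = 2 * s"
    using \<open>x > 0\<close> by (simp_all add: s_def field_simps)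
  have K: "K \<noteq> 0"
    using s by (simp add: K_def)
  have c: "c * of_real x = (1 + \<i>) * of_real s" and c': "cnj c * of_real x = (1 - \<i>) * of_real s"
    using \<open>x > 0\<close>
    by (simp_all add: c_def s_def complex_eq_iff Re_exp Im_exp cos_45 sin_45 real_div_sqrt field_simps)
  note Fint = circle_kernel_exp_integrable[OF \<mu>, of n K d, folded F_def]
  note fold = integral_fold_symmetric[OF Fint]
  have F_eq: "F t = exp (\<i> * of_real t * \<nu>) * exp (d * cis t)
      * (circle_kernel \<mu> K t * exp (- (\<i> * of_real t * \<mu>)))" for t
  proof -
    have "exp (\<i> * of_real t * \<nu>) = exp (\<i> * of_real t * \<mu>) * cis t ^ n"
      by (simp add: n cis_conv_exp exp_of_nat_mult[symmetric] exp_add[symmetric] algebra_simps)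
    then show ?thesis
      by (simp add: F_def exp_minus field_simps)
  qed
  have f_eq: "f t = K powr \<mu> * exp (- 2 * K) / 2 * (F t + F (- t))" if t: "t \<in> {-pi<..<pi}" for t
  proof -
    define g where "g = circle_kernel \<mu> K t * exp (- (\<i> * of_real t * \<mu>))"
    define z where "z = \<nu> * of_real t + d * of_real (sin t)"
    have cis_eq: "cis t = of_real (cos t) + \<i> * of_real (sin t)" for t
      by (simp add: complex_eq_iff)
    have w: "- \<i> * of_real (sqrt 2 * x * (1 + cos t)) = 2 * K * of_real (1 + cos t)"
      unfolding s(2) by (simp add: K_def)
    have P: "gamma_P \<mu> (2 * K * of_real (1 + cos t)) = K powr \<mu> * exp (- (2 * K * of_real (1 + cos t))) * g"
    proof -
      have "gamma_P \<mu> (2 * K * of_real (1 + cos t)) = exp (- (\<i> * of_real t * \<mu>)) *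
          (exp (\<i> * of_real t * \<mu>) * gamma_P \<mu> (2 * K * of_real (1 + cos t)))"
        by (simp add: exp_minus)
      also have "\<dots> = K powr \<mu> * exp (- (2 * K * of_real (1 + cos t))) * g"
        unfolding gamma_P_conv_circle_kernel[OF t K] by (simp add: g_def mult_ac)
      finally show ?thesis .
    qed
    have g': "circle_kernel \<mu> K (- t) * exp (- (\<i> * of_real (- t) * \<mu>)) = g"
      using t by (simp add: g_def circle_kernel_eq exp_minus)
    \<comment> \<open>Since \<open>- c * x - 2 * K = d\<close>, the two exponentials combine to the
      same coefficient \<open>d\<close> that stands before \<open>sin t\<close> in \<open>z\<close>.
      Hence \<open>d * cos t + \<i> * z\<close> becomes
      \<open>\<i> * t * \<nu> + d * cis t\<close>.\<close>
    have "exp (- (c * of_real x * of_real (cos t))) * exp (- (2 * K * of_real (1 + cos t)))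
        = exp (- 2 * K) * exp (d * of_real (cos t))"
      by (simp add: exp_add[symmetric] c c' K_def d_def algebra_simps)
    moreover have "f t = exp (- (c * of_real x * of_real (cos t)))
        * (K powr \<mu> * exp (- (2 * K * of_real (1 + cos t))) * g) * cos z"
      unfolding f_def w P[folded \<mu>_def] \<mu>_def[symmetric] by (simp add: P z_def d_def)
    ultimately have "f t = K powr \<mu> * exp (- 2 * K) * g * (exp (d * of_real (cos t)) * cos z)"
      by (metis (no_types, lifting) mult.assoc mult.commute)
    also have "exp (d * of_real (cos t)) * cos z
        = (exp (d * of_real (cos t) + \<i> * z) + exp (d * of_real (cos t) - \<i> * z)) / 2"
      by (simp add: cos_exp_eq exp_add exp_diff exp_minus field_simps)
    also have "exp (d * of_real (cos t) + \<i> * z) = exp (\<i> * of_real t * \<nu>) * exp (d * cis t)"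
      unfolding z_def exp_add[symmetric] by (simp add: cis_eq algebra_simps)
    also have "exp (d * of_real (cos t) - \<i> * z) = exp (\<i> * of_real (- t) * \<nu>) * exp (d * cis (- t))"
      unfolding z_def exp_add[symmetric] by (simp add: cis_eq algebra_simps)
    finally show ?thesis
      unfolding F_eq[of t] F_eq[of "- t"] g' g_def[symmetric] by (simp add: field_simps)
  qed
  define C where "C = K powr \<mu> * exp (- 2 * K) / 2"
  have CF: "(\<lambda>t. C * (F t + F (- t))) absolutely_integrable_on {0..pi}"
    using fold(1) by (intro set_integrable_mult_right) auto
  \<comment> \<open>The point \<open>pi\<close> is left out because the argument of
    \<open>gamma_P\<close> vanishes there; a single point does not affect the integral.\<close>
  have f_eq': "f t = C * (F t + F (- t))" if "t \<in> {0..pi} - {pi}" for t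
    unfolding C_def using that by (intro f_eq) auto
  have 1: "f absolutely_integrable_on {0..pi}"
    by (rule absolutely_integrable_spike[OF CF, of "{pi}"]) (auto simp: f_eq')
  have "integral {0..pi} f = integral {0..pi} (\<lambda>t. C * (F t + F (- t)))"
    by (rule integral_spike[of "{pi}"]) (auto simp: f_eq')
  also have "\<dots> = C * integral {-pi..pi} F"
    using fold(2) by simp
  also have "integral {-pi..pi} F = 2 * of_real pi * K ^ n * exp (2 * K) * bessel_clifford \<nu> (K\<^sup>2 + d * K)"
    unfolding F_def n by (rule circle_kernel_exp_integral) (rule \<mu>)
  also have "C * \<dots> = of_real pi * K powr \<nu> * bessel_clifford \<nu> (K\<^sup>2 + d * K)"
    using K by (simp add: C_def n powr_add powr_nat' exp_minus)
  finally have int: "integral {0..pi} f = \<dots>" .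
  \<comment> \<open>Half of the argument of \<open>Bessel_J\<close>. The computation of
    \<open>- (y\<^sup>2)\<close> shows that the integral has produced the right Bessel-Clifford
    value.\<close>
  define y where "y = of_real s * cis (- (pi / 4))"
  have y: "of_real (sqrt 2 * x) * exp (- (\<i> * of_real pi / 4)) / 2 = y"
    unfolding s(2) by (simp add: y_def cis_conv_exp)
  have y0: "y \<noteq> 0" using s by (simp add: y_def)
  have "- (y\<^sup>2) = \<i> * of_real (s\<^sup>2)"
    by (simp add: y_def power_mult_distrib Complex.DeMoivre)
  also have "\<dots> = K\<^sup>2 + d * K"
    by (simp add: K_def d_def c' power2_eq_square algebra_simps)
  finally have arg: "- (y\<^sup>2) = K\<^sup>2 + d * K" .
  have "K = of_real s * cis (- (pi / 2))" by (simp add: K_def)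
  then have "K powr \<nu> = of_real s powr \<nu> * exp (\<i> * of_real (- (pi / 2)) * \<nu>)"
    using s by (simp only:) (rule of_real_cis_powr; use pi_gt_zero in linarith)
  moreover have "y powr \<nu> = of_real s powr \<nu> * exp (\<i> * of_real (- (pi / 4)) * \<nu>)"
    unfolding y_def using s by (intro of_real_cis_powr; use pi_gt_zero in linarith)
  \<comment> \<open>The arguments of \<open>y\<close> and \<open>K\<close> are
    \<open>- pi / 4\<close> and \<open>- pi / 2\<close>. The constant in the theorem reflects
    \<open>1 - 1/4 = 5/4 - 1/2\<close>.\<close>
  moreover have "exp (\<i> * of_real pi * \<nu>) * exp (\<i> * of_real (- (pi / 4)) * \<nu>)
      = exp (\<i> * 5 * of_real pi * \<nu> / 4) * exp (\<i> * of_real (- (pi / 2)) * \<nu>)"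
    by (simp add: exp_add[symmetric] algebra_simps)
  ultimately have "exp (\<i> * of_real pi * \<nu>) * y powr \<nu> = exp (\<i> * 5 * of_real pi * \<nu> / 4) * K powr \<nu>"
    by (simp add: mult.left_commute)
  moreover have "cpow y \<nu> = y powr \<nu>"
    using y0 by (simp add: cpow_def)
  ultimately have "kelvin_ber_bei \<nu> (sqrt 2 * x)
      = exp (\<i> * 5 * of_real pi * \<nu> / 4) / of_real pi * integral {0..pi} f"
    unfolding kelvin_ber_bei_def Bessel_J_conv_bessel_clifford y arg int by simp
  with 1 show ?thesis ..
qed

end
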